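(* There exist a one-parameter semigroup $(\varphi_t)_{t\ge0}$ of holomorphic self-maps of $\mathbb{D}$ that is not a group, a non-regular backward orbit $\gamma$ of $(\varphi_t)$, and a point $\zeta$ lying on $\gamma$, such that $$\lim_{t\to-\infty}\frac{d_{\mathbb{D}}(\zeta,\varphi_t(\zeta))}{t^2}=0.$$ Furthermore, there exist a one-parameter semigroup $(\psi_t)_{t\ge0}$ of holomorphic self-maps of $\mathbb{D}$ that is not a group, a non-regular backward orbit $\tilde\gamma$ of $(\psi_t)$, and a point $\zeta$ lying on $\tilde\gamma$, such that $$\liminf_{t\to-\infty}\frac{d_{\mathbb{D}}(\zeta,\psi_t(\zeta))}{t^2}\ge\frac14.$$
   Context: $\mathbb{D}$ is the unit disk, and $d_{\mathbb{D}}(z,w)=\operatorname{arctanh}\left|\frac{z-w}{1-\bar z w}\right|$ is its hyperbolic distance. A (one-parameter) semigroup in $\mathbb{D}$ is a family $(\phi_t)_{t\ge0}$ of holomorphic self-maps of $\mathbb{D}$ with $\phi_0=\mathrm{id}$, $\phi_{t+s}=\phi_t\circ\phi_s$ for all $t,s\ge0$, and $\phi_t(z)\to z$ uniformly on compacta as $t\to0^+$. It is a group if some (equivalently every) $\phi_{t_0}$, $t_0>0$, is an automorphism of $\mathbb{D}$. The maps $\phi_t$ are injective. A backward orbit of $(\phi_t)$ is a continuous curve $\gamma:[0,+\infty)\to\mathbb{D}$ with $\phi_s(\gamma(t))=\gamma(t-s)$ for all $t\ge s\ge0$. It is regular if $\limsup_{t\to+\infty}d_{\mathbb{D}}(\gamma(t),\gamma(t+1))<+\infty$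 and non-regular if this limit superior is $+\infty$. For $\zeta$ lying on a backward orbit and $t\le0$, $\phi_t(\zeta):=\phi_{-t}^{-1}(\zeta)$ (so if $\zeta=\gamma(s)$, then $\phi_t(\zeta)=\gamma(s-t)$). *)

theory Defs
  imports "HOL-Complex_Analysis.Complex_Analysis"
begin

abbreviation unit_disk :: "complex set" where
  "unit_disk \<equiv> ball 0 1"

definition hyp_dist :: "complex \<Rightarrow> complex \<Rightarrow> real" where
  "hyp_dist z w = artanh (cmod ((z - w) / (1 - cnj z * w)))"

(* Only the values at t >= 0 and z in the unit disk matter; all conditions are
   relativised accordingly. *)
definition semigroup_in_disk :: "(real \<Rightarrow> complex \<Rightarrow> complex) \<Rightarrow> bool" where
  "semigroup_in_disk \<phi> \<longleftrightarrow>
     (\<forall>t\<ge>0. \<phi> t holomorphic_on unit_disk \<and> \<phi> t ` unit_disk \<subseteq> unit_disk) \<and>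
     (\<forall>z\<in>unit_disk. \<phi> 0 z = z) \<and>
     (\<forall>t\<ge>0. \<forall>s\<ge>0. \<forall>z\<in>unit_disk. \<phi> (t + s) z = \<phi> t (\<phi> s z)) \<and>
     (\<forall>K. compact K \<and> K \<subseteq> unit_disk \<longrightarrow> uniform_limit K \<phi> (\<lambda>z. z) (at_right 0))"

definition disk_automorphism :: "(complex \<Rightarrow> complex) \<Rightarrow> bool" where
  "disk_automorphism f \<longleftrightarrow>
     f holomorphic_on unit_disk \<and> bij_betw f unit_disk unit_disk \<and>
     inv_into unit_disk f holomorphic_on unit_disk"

definition group_in_disk :: "(real \<Rightarrow> complex \<Rightarrow> complex) \<Rightarrow> bool" where
  "group_in_disk \<phi> \<longleftrightarrow> semigroup_in_disk \<phi> \<and> (\<exists>t>0. disk_automorphism (\<phi> t))"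

definition backward_orbit :: "(real \<Rightarrow> complex \<Rightarrow> complex) \<Rightarrow> (real \<Rightarrow> complex) \<Rightarrow> bool" where
  "backward_orbit \<phi> \<gamma> \<longleftrightarrow>
     continuous_on {0..} \<gamma> \<and> \<gamma> ` {0..} \<subseteq> unit_disk \<and>
     (\<forall>s t. 0 \<le> s \<and> s \<le> t \<longrightarrow> \<phi> s (\<gamma> t) = \<gamma> (t - s))"

definition non_regular :: "(real \<Rightarrow> complex) \<Rightarrow> bool" where
  "non_regular \<gamma> \<longleftrightarrow> Limsup at_top (\<lambda>t. ereal (hyp_dist (\<gamma> t) (\<gamma> (t + 1)))) = \<infinity>"

(* Extension of a semigroup to negative times by inversion in the disk. For t < 0 it
   is meaningful where z lies in the image of the disk under \<phi> (-t), in
   particular at every point of a backward orbit; elsewhere the value is unspecified. *)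
definition semigroup_at :: "(real \<Rightarrow> complex \<Rightarrow> complex) \<Rightarrow> real \<Rightarrow> complex \<Rightarrow> complex" where
  "semigroup_at \<phi> t z = (if 0 \<le> t then \<phi> t z else inv_into unit_disk (\<phi> (- t)) z)"

end

theory Submission
  imports Defs "HOL-Real_Asymp.Real_Asymp"
begin

text \<open>
  Both semigroups are translations \<open>w \<mapsto> w + t\<close> in a Koenigs domain
  \<open>\<Omega> = {x + iy. y < f x}\<close>, read in the disk through a Riemann map. Since \<open>f\<close> increases, \<open>\<Omega>\<close> is
  mapped into itself by every shift to the right; since \<open>f\<close> is positive, the real line lies in
  \<open>\<Omega>\<close> and, traversed to the left, is a backward orbit. How fast \<open>f\<close> tends to \<open>0\<close> at \<open>-\<infinity>\<close>
  decides how fast this orbit leaves its starting point, and no formula for the Riemann map is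
  needed to see it: a holomorphic map from or to a half-plane bounds distances by the
  Schwarz-Pick lemma.

  Lower bounds come from enlarging \<open>\<Omega>\<close>. By monotonicity \<open>\<Omega>\<close> omits the horizontal half-line that
  ends at \<open>-a + i f (-a)\<close> and runs to the left, and a square root maps the complement of this
  slit to the right half-plane (\<open>hyp_dist_orbit_ge\<close>). A point of the orbit one unit behind the tip
  is squeezed under the slit: its image has real part of order \<open>f (-a)\<close>. The point below the
  tip has an image with real part of order \<open>sqrt (f (-a))\<close>. Hence one unit of time costs at least
  about \<open>ln (1 / f (-a)) / 4\<close>, which is unbounded when \<open>f\<close> tends to \<open>0\<close>, so the orbit is not regular
  (\<open>non_regular_orbit\<close>). A starting point far in front of the tip has an image with real part at
  least \<open>1\<close>, so the distance travelled up to time \<open>t\<close> is at least about \<open>ln (1 / f (1 - t)) / 2\<close>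
  (\<open>hyp_dist_orbit_0_ge\<close>). The choice \<open>f x = exp (- exp (- x))\<close> makes this exponential in \<open>t\<close>, which
  exceeds \<open>t\<^sup>2 / 4\<close>.

  Upper bounds come from shrinking \<open>\<Omega>\<close> to the half-plane below a line that stays below the graph
  (\<open>Moebius_orbit_le_of_line_below\<close>). For \<open>f = exp\<close>, convexity allows the tangent at \<open>-t\<close>; the
  distance between \<open>0\<close> and \<open>-t\<close> in the half-plane below it is \<open>t + O(ln t)\<close>
  (\<open>hyp_dist_orbit_exp_le\<close>), which is \<open>o(t\<^sup>2)\<close>.
\<close>

section \<open>Schwarz-Pick estimates between the disk and the right half-plane\<close>

lemma hyp_dist_eq_artanh_Moebius: "hyp_dist z w = artanh (cmod (Moebius_function 0 z w))"
  by (simp add: hyp_dist_def Moebius_function_simple norm_divide norm_minus_commute)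

lemma cmod_Moebius_less_1:
  assumes "z \<in> unit_disk" "w \<in> unit_disk"
  shows "cmod (Moebius_function 0 z w) < 1"
  using assms by (intro Moebius_function_norm_lt_1) auto

lemma artanh_mono_real:
  fixes x y :: real
  assumes "0 \<le> x" "x \<le> y" "y < 1"
  shows "artanh x \<le> artanh y"
  unfolding artanh_def using assms by (auto intro!: divide_right_mono frac_le)

lemma hyp_dist_nonneg:
  assumes "z \<in> unit_disk" "w \<in> unit_disk"
  shows "0 \<le> hyp_dist z w"
  using artanh_mono_real[of 0 "cmod (Moebius_function 0 z w)"] cmod_Moebius_less_1[OF assms]
  by (simp add: hyp_dist_eq_artanh_Moebius)

lemma halfplane_pseudodistance_less_1:
  assumes "Re u > 0" "Re v > 0"
  shows "cmod ((u - v) / (u + cnj v)) < 1"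
proof -
  have "(cmod (u - v))\<^sup>2 < (cmod (u + cnj v))\<^sup>2"
    using mult_pos_pos[OF assms]
    unfolding cmod_power2 by (simp add: power2_eq_square algebra_simps)
  then have "cmod (u - v) < cmod (u + cnj v)"
    by (simp add: power_less_imp_less_base)
  then show ?thesis
    by (simp add: norm_divide divide_less_eq)
qed

text \<open>Each of the two estimates is the Schwarz lemma for the map conjugated by automorphisms that
  move the base point and its image to the centre of the disk; \<open>(u - v) / (u + cnj v)\<close> is the
  Cayley map of the half-plane that sends \<open>v\<close> to the centre.\<close>

lemma Schwarz_Pick_disk_to_halfplane:
  assumes hol: "p holomorphic_on unit_disk"
    and Re_pos: "\<And>z. z \<in> unit_disk \<Longrightarrow> Re (p z) > 0"
    and z: "z \<in> unit_disk" and w: "w \<in> unit_disk"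
  shows "cmod ((p w - p z) / (p w + cnj (p z))) \<le> cmod (Moebius_function 0 z w)"
proof -
  let ?M = "Moebius_function 0 (- z)"
  define F where "F \<xi> = (p (?M \<xi>) - p z) / (p (?M \<xi>) + cnj (p z))" for \<xi>
  have M_in: "?M \<xi> \<in> unit_disk" if "\<xi> \<in> unit_disk" for \<xi>
    using that z Moebius_function_norm_lt_1[of "- z" \<xi> 0] by auto
  have M_hol: "?M holomorphic_on unit_disk"
    using z by (intro Moebius_function_holomorphic) auto
  have pM_hol: "(\<lambda>\<xi>. p (?M \<xi>)) holomorphic_on unit_disk"
    using holomorphic_on_compose_gen[OF M_hol hol] M_in by (simp add: o_def image_subset_iff)
  have denom: "p (?M \<xi>) + cnj (p z) \<noteq> 0" if "\<xi> \<in> unit_disk" for \<xi>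
  proof -
    have "Re (p (?M \<xi>) + cnj (p z)) > 0"
      using Re_pos[OF M_in[OF that]] Re_pos[OF z] by simp
    then show ?thesis by (metis less_irrefl zero_complex.simps(1))
  qed
  have F_hol: "F holomorphic_on unit_disk"
    unfolding F_def by (intro holomorphic_intros pM_hol denom)
  have F_0: "F 0 = 0"
    by (simp add: F_def Moebius_function_of_zero)
  have F_less_1: "cmod (F \<xi>) < 1" if "cmod \<xi> < 1" for \<xi>
    unfolding F_def using that
    by (intro halfplane_pseudodistance_less_1 Re_pos M_in z) auto
  have "cmod (F (Moebius_function 0 z w)) \<le> cmod (Moebius_function 0 z w)"
    using Schwarz_Lemma(1)[OF F_hol F_0 F_less_1 cmod_Moebius_less_1[OF z w]] .
  moreover have "?M (Moebius_function 0 z w) = w"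
    using z w by (intro Moebius_function_compose) auto
  ultimately show ?thesis
    by (simp add: F_def)
qed

lemma Schwarz_Pick_halfplane_to_disk:
  assumes hol: "p holomorphic_on {u. Re u > 0}"
    and p_in: "\<And>u. Re u > 0 \<Longrightarrow> p u \<in> unit_disk"
    and u: "Re u > 0" and v: "Re v > 0"
  shows "cmod (Moebius_function 0 (p v) (p u)) \<le> cmod ((u - v) / (u + cnj v))"
proof -
  \<comment> \<open>The inverse of the Cayley map: it sends the centre of the disk to \<open>v\<close>.\<close>
  define C where "C \<xi> = (v + cnj v * \<xi>) / (1 - \<xi>)" for \<xi>
  let ?\<xi> = "(u - v) / (u + cnj v)"
  have C_Re: "Re (C \<xi>) > 0" if "cmod \<xi> < 1" for \<xi>
  proof -
    have ne: "1 - \<xi> \<noteq> 0" using that by auto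
    have "Re (C \<xi>) = Re ((v + cnj v * \<xi>) * cnj (1 - \<xi>)) / (cmod (1 - \<xi>))\<^sup>2"
      unfolding C_def complex_div_cnj[of "v + cnj v * \<xi>"]
      by (metis Re_divide_of_real of_real_power)
    also have "Re ((v + cnj v * \<xi>) * cnj (1 - \<xi>)) = Re v * (1 - (cmod \<xi>)\<^sup>2)"
      unfolding cmod_power2 by (simp add: power2_eq_square algebra_simps)
    finally have "Re (C \<xi>) = Re v * (1 - (cmod \<xi>)\<^sup>2) / (cmod (1 - \<xi>))\<^sup>2" .
    moreover have "(cmod \<xi>)\<^sup>2 < 1"
      using that by (simp add: power_less_one_iff abs_square_less_1)
    ultimately show ?thesis using v ne by simp
  qed
  have C_hol: "C holomorphic_on unit_disk"
    unfolding C_def by (intro holomorphic_intros) auto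
  define F where "F \<xi> = Moebius_function 0 (p v) (p (C \<xi>))" for \<xi>
  have pC_hol: "(p \<circ> C) holomorphic_on unit_disk"
    using C_Re by (intro holomorphic_on_compose_gen[OF C_hol hol]) auto
  have M_hol: "Moebius_function 0 (p v) holomorphic_on unit_disk"
    using p_in[OF v] by (intro Moebius_function_holomorphic) auto
  have "(Moebius_function 0 (p v) \<circ> (p \<circ> C)) holomorphic_on unit_disk"
    using C_Re p_in by (intro holomorphic_on_compose_gen[OF pC_hol M_hol]) auto
  then have F_hol: "F holomorphic_on unit_disk"
    by (simp add: F_def[abs_def] o_def)
  have F_0: "F 0 = 0"
    by (simp add: F_def C_def Moebius_function_eq_zero)
  have F_less_1: "cmod (F \<xi>) < 1" if "cmod \<xi> < 1" for \<xi>
    unfolding F_def using that by (intro cmod_Moebius_less_1 p_in v C_Re)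
  have "cmod (F ?\<xi>) \<le> cmod ?\<xi>"
    using Schwarz_Lemma(1)[OF F_hol F_0 F_less_1 halfplane_pseudodistance_less_1[OF u v]] .
  moreover have "C ?\<xi> = u"
  proof -
    have "Re (u + cnj v) > 0" using u v by simp
    then have ne: "u + cnj v \<noteq> 0" by (metis less_irrefl zero_complex.simps(1))
    have "Re (v + cnj v) > 0" using v by simp
    then have ne': "v + cnj v \<noteq> 0" by (metis less_irrefl zero_complex.simps(1))
    have "1 - ?\<xi> = (v + cnj v) / (u + cnj v)"
      using ne by (simp add: field_simps)
    moreover have "v + cnj v * ?\<xi> = u * (v + cnj v) / (u + cnj v)"
      using ne by (simp add: field_simps)
    ultimately show ?thesis using ne ne' by (simp add: C_def)
  qed
  ultimately show ?thesis by (simp add: F_def)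
qed

text \<open>In the right half-plane the distance between two points is smallest, for prescribed real
  parts, when they lie on a common horizontal line; there it is half the logarithm of the ratio
  of the real parts.\<close>

lemma hyp_dist_ge_ln_ratio_Re:
  assumes hol: "p holomorphic_on unit_disk"
    and Re_pos: "\<And>z. z \<in> unit_disk \<Longrightarrow> Re (p z) > 0"
    and z: "z \<in> unit_disk" and w: "w \<in> unit_disk"
    and le: "Re (p w) \<le> Re (p z)"
  shows "ln (Re (p z) / Re (p w)) / 2 \<le> hyp_dist z w"
proof -
  define a b d where "a = Re (p z)" and "b = Re (p w)" and "d = Im (p w) - Im (p z)"
  have ab: "0 < b" "b \<le> a"
    using Re_pos z w le by (auto simp: a_def b_def)
  have "((a - b) / (a + b))\<^sup>2 \<le> ((a - b)\<^sup>2 + d\<^sup>2) / ((a + b)\<^sup>2 + d\<^sup>2)"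
  proof -
    have "(a - b)\<^sup>2 * d\<^sup>2 \<le> (a + b)\<^sup>2 * d\<^sup>2"
      using ab by (intro mult_right_mono power_mono) auto
    then have "(a - b)\<^sup>2 * ((a + b)\<^sup>2 + d\<^sup>2) \<le> ((a - b)\<^sup>2 + d\<^sup>2) * (a + b)\<^sup>2"
      by (simp add: algebra_simps)
    moreover have "0 < (a + b)\<^sup>2" "0 < (a + b)\<^sup>2 + d\<^sup>2"
      using ab by (auto intro: add_pos_nonneg)
    ultimately show ?thesis
      by (simp add: power_divide frac_le_eq divide_le_eq le_divide_eq field_simps)
  qed
  also have "\<dots> = (cmod ((p w - p z) / (p w + cnj (p z))))\<^sup>2"
    by (simp add: norm_divide power_divide cmod_power2 a_def b_def d_def power2_commute add.commute)
  finally have "(a - b) / (a + b) \<le> cmod ((p w - p z) / (p w + cnj (p z)))"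
    by (rule power2_le_imp_le) simp
  also have "\<dots> \<le> cmod (Moebius_function 0 z w)"
    by (rule Schwarz_Pick_disk_to_halfplane[OF hol Re_pos z w])
  finally have "artanh ((a - b) / (a + b)) \<le> hyp_dist z w"
    unfolding hyp_dist_eq_artanh_Moebius
    using ab cmod_Moebius_less_1[OF z w] by (intro artanh_mono_real) auto
  moreover have "(1 + (a - b) / (a + b)) / (1 - (a - b) / (a + b)) = a / b"
  proof -
    have "1 + (a - b) / (a + b) = 2 * a / (a + b)" "1 - (a - b) / (a + b) = 2 * b / (a + b)"
      using ab by (simp_all add: field_simps)
    then show ?thesis using ab by simp
  qed
  ultimately show ?thesis by (simp add: artanh_def a_def b_def)
qed

section \<open>Semigroups with an increasing subgraph as Koenigs domain\<close>

definition subgraph :: "(real \<Rightarrow> real) \<Rightarrow> complex set" where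
  "subgraph f = {w. Im w < f (Re w)}"

text \<open>Here \<open>h\<close> is the Koenigs function and \<open>k\<close> its inverse, a Riemann map of the domain; in the
  coordinate \<open>h\<close> the semigroup is a translation.\<close>

locale koenigs_model =
  fixes f :: "real \<Rightarrow> real" and h k :: "complex \<Rightarrow> complex"
  assumes f_strict_mono: "strict_mono f" and f_pos: "0 < f x"
    and h_hol: "h holomorphic_on unit_disk" and k_hol: "k holomorphic_on subgraph f"
    and h_in: "z \<in> unit_disk \<Longrightarrow> h z \<in> subgraph f"
    and k_in: "w \<in> subgraph f \<Longrightarrow> k w \<in> unit_disk"
    and k_h: "z \<in> unit_disk \<Longrightarrow> k (h z) = z"
    and h_k: "w \<in> subgraph f \<Longrightarrow> h (k w) = w"
begin

definition flow :: "real \<Rightarrow> complex \<Rightarrow> complex" where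
  "flow t z = k (h z + of_real t)"

definition orbit :: "real \<Rightarrow> complex" where
  "orbit t = k (- of_real t)"

lemma shift_in_subgraph:
  assumes "w \<in> subgraph f" "0 \<le> t"
  shows "w + of_real t \<in> subgraph f"
proof -
  have "f (Re w) \<le> f (Re w + t)"
    using strict_mono_leD[OF f_strict_mono] assms by simp
  then show ?thesis using assms by (simp add: subgraph_def)
qed

lemma of_real_in_subgraph: "of_real x \<in> subgraph f"
  using f_pos by (simp add: subgraph_def)

lemma orbit_in: "orbit t \<in> unit_disk"
  unfolding orbit_def by (intro k_in) (use of_real_in_subgraph[of "-t"] in simp)

lemma h_orbit: "h (orbit t) = - of_real t"
  unfolding orbit_def by (intro h_k) (use of_real_in_subgraph[of "-t"] in simp)

lemma flow_in: "z \<in> unit_disk \<Longrightarrow> 0 \<le> t \<Longrightarrow> flow t z \<in> unit_disk"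
  unfolding flow_def by (intro k_in shift_in_subgraph h_in)

lemma h_flow: "z \<in> unit_disk \<Longrightarrow> 0 \<le> t \<Longrightarrow> h (flow t z) = h z + of_real t"
  unfolding flow_def by (intro h_k shift_in_subgraph h_in)

lemma flow_holomorphic:
  assumes "0 \<le> t"
  shows "flow t holomorphic_on unit_disk"
proof -
  have "(\<lambda>z. h z + of_real t) holomorphic_on unit_disk"
    by (intro holomorphic_intros h_hol)
  then have "(k \<circ> (\<lambda>z. h z + of_real t)) holomorphic_on unit_disk"
    by (rule holomorphic_on_compose_gen[OF _ k_hol]) (use assms shift_in_subgraph h_in in auto)
  then show ?thesis by (simp add: flow_def[abs_def] o_def)
qed

lemma flow_uniform_limit:
  assumes K: "compact K" "K \<subseteq> unit_disk"
  shows "uniform_limit K flow (\<lambda>z. z) (at_right 0)"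
proof (rule uniform_limitI)
  fix e :: real assume e: "0 < e"
  let ?P = "\<lambda>(t::real, z). h z + of_real t" and ?D = "{0..1::real} \<times> K"
  have "continuous_on K h"
    using h_hol K(2) by (meson continuous_on_subset holomorphic_on_imp_continuous_on)
  then have hc: "continuous_on ?D (\<lambda>x. h (snd x))"
    by (rule continuous_on_compose2[OF _ continuous_on_snd[OF continuous_on_id]]) auto
  have "continuous_on ?D ?P"
    unfolding case_prod_beta by (intro continuous_intros hc)
  then have "continuous_on ?D (\<lambda>x. k (?P x))"
    by (rule continuous_on_compose2[OF holomorphic_on_imp_continuous_on[OF k_hol]])
      (use K(2) in \<open>auto intro!: shift_in_subgraph h_in\<close>)
  moreover have "compact ?D" by (intro compact_Times K compact_Icc)
  ultimately have "uniformly_continuous_on ?D (\<lambda>x. k (?P x))"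
    by (rule compact_uniformly_continuous)
  then obtain d where d: "0 < d"
    "\<And>x y. x \<in> ?D \<Longrightarrow> y \<in> ?D \<Longrightarrow> dist y x < d \<Longrightarrow> dist (k (?P y)) (k (?P x)) < e"
    unfolding uniformly_continuous_on_def using e by meson
  have "\<forall>z\<in>K. dist (flow t z) z < e" if t: "0 < t" "t < min d 1" for t
  proof
    fix z assume z: "z \<in> K"
    have "dist (k (?P (t, z))) (k (?P (0, z))) < e"
      by (rule d(2)) (use t z in \<open>auto simp: dist_prod_def\<close>)
    moreover have "k (h z) = z" using z K(2) by (auto intro: k_h)
    ultimately show "dist (flow t z) z < e" by (simp add: flow_def)
  qed
  then show "\<forall>\<^sub>F t in at_right 0. \<forall>z\<in>K. dist (flow t z) z < e"
    unfolding eventually_at_right_field using d(1)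
    by (intro exI[of _ "min d 1"]) auto
qed

lemma semigroup_flow: "semigroup_in_disk flow"
proof -
  have "flow (t + s) z = flow t (flow s z)" if "0 \<le> t" "0 \<le> s" "z \<in> unit_disk" for t s z
  proof -
    have "flow t (flow s z) = k (h (flow s z) + of_real t)"
      by (simp add: flow_def)
    also have "\<dots> = flow (t + s) z"
      using h_flow[OF that(3,2)] by (simp add: flow_def algebra_simps)
    finally show ?thesis by simp
  qed
  moreover have "flow 0 z = z" if "z \<in> unit_disk" for z
    using k_h[OF that] by (simp add: flow_def)
  ultimately show ?thesis
    unfolding semigroup_in_disk_def
    using flow_holomorphic flow_in flow_uniform_limit by (auto simp: image_subset_iff)
qed

text \<open>A strictly increasing boundary moves strictly upwards under the shift to the right, so
  the shift cannot be surjective: the boundary point over \<open>-t\<close>, moved right by \<open>t\<close>, lies inside.\<close>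

lemma not_group_flow: "\<not> group_in_disk flow"
proof
  assume "group_in_disk flow"
  then obtain t where t: "0 < t" "disk_automorphism (flow t)"
    by (auto simp: group_in_disk_def)
  define w where "w = Complex 0 (f (- t))"
  have w: "w \<in> subgraph f"
    using strict_monoD[OF f_strict_mono, of "-t" 0] t by (simp add: subgraph_def w_def)
  have "k w \<in> flow t ` unit_disk"
    using t(2) k_in[OF w] by (simp add: disk_automorphism_def bij_betw_def)
  then obtain z where z: "z \<in> unit_disk" "flow t z = k w" by auto
  have "h z + of_real t = w"
    using h_flow[OF z(1), of t] z(2) h_k[OF w] t(1) by simp
  then have "h z = w - of_real t" by (simp add: algebra_simps)
  then have "h z = Complex (- t) (f (- t))" by (simp add: w_def complex_eq_iff)
  then show False using h_in[OF z(1)] by (simp add: subgraph_def)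
qed

lemma flow_orbit: "flow s (orbit t) = orbit (t - s)"
  unfolding flow_def h_orbit by (simp add: orbit_def)

lemma backward_orbit_orbit: "backward_orbit flow orbit"
proof -
  have "continuous_on {0..} orbit"
    unfolding orbit_def
    by (rule continuous_on_compose2[OF holomorphic_on_imp_continuous_on[OF k_hol]])
      (use of_real_in_subgraph in \<open>auto intro!: continuous_intros simp flip: of_real_minus\<close>)
  then show ?thesis
    using orbit_in flow_orbit by (auto simp: backward_orbit_def)
qed

lemma semigroup_at_orbit:
  assumes "0 \<le> t"
  shows "semigroup_at flow (- t) (orbit 0) = orbit t"
proof (cases "t = 0")
  case True
  then show ?thesis using flow_orbit[of 0 0] by (simp add: semigroup_at_def)
next
  case False
  have "inj_on (flow t) unit_disk"
  proof (rule inj_onI)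
    fix x y assume "x \<in> unit_disk" "y \<in> unit_disk" "flow t x = flow t y"
    then show "x = y"
      using h_flow[of x t] h_flow[of y t] assms k_h by (metis add_right_cancel)
  qed
  then have "inv_into unit_disk (flow t) (flow t (orbit t)) = orbit t"
    by (rule inv_into_f_f[OF _ orbit_in])
  then show ?thesis
    using False assms flow_orbit[of t t] by (simp add: semigroup_at_def)
qed

text \<open>Since \<open>f\<close> increases, the domain omits the horizontal half-line running to the left from
  the boundary point over \<open>-a\<close>, and the square root maps the plane slit along that half-line to
  the right half-plane. The point \<open>-a - 1\<close>, one unit behind the tip and \<open>f (-a)\<close> below the slit, has
  an image of real part at most \<open>f (-a) / 2\<close>; the number \<open>c\<close> bounds the real part of the image of
  \<open>-s\<close> from below.\<close>

lemma hyp_dist_orbit_ge: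
  assumes s: "s \<le> a" and c: "0 < c" "c \<le> Re (csqrt (Complex (a - s) (- f (- a))))"
    "f (- a) \<le> 2 * c"
  shows "ln (2 * c / f (- a)) / 2 \<le> hyp_dist (orbit s) (orbit (a + 1))"
proof -
  define b where "b = f (- a)"
  have b: "0 < b" using f_pos by (simp add: b_def)
  define p where "p z = csqrt (h z + Complex a (- b))" for z
  have slit: "h z + Complex a (- b) \<notin> \<real>\<^sub>\<le>\<^sub>0" if "z \<in> unit_disk" for z
  proof
    assume "h z + Complex a (- b) \<in> \<real>\<^sub>\<le>\<^sub>0"
    then have Re: "Re (h z) \<le> - a" and Im: "Im (h z) = b"
      by (auto simp: complex_nonpos_Reals_iff)
    have "f (Re (h z)) \<le> b"
      unfolding b_def using strict_mono_leD[OF f_strict_mono Re] .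
    then show False using Im h_in[OF that] by (simp add: subgraph_def)
  qed
  have p_hol: "p holomorphic_on unit_disk"
    unfolding p_def by (intro holomorphic_intros h_hol slit)
  have p_Re: "Re (p z) > 0" if "z \<in> unit_disk" for z
  proof -
    have "Re (p z) \<noteq> 0"
    proof
      assume 0: "Re (p z) = 0"
      have "(p z)\<^sup>2 \<in> \<real>\<^sub>\<le>\<^sub>0"
        using 0 by (simp add: complex_nonpos_Reals_iff power2_eq_square)
      then show False using slit[OF that] by (simp add: p_def del: csqrt.simps)
    qed
    then show ?thesis using Re_csqrt[of "h z + Complex a (- b)"] by (simp add: p_def del: csqrt.simps)
  qed
  have eq_s: "p (orbit s) = csqrt (Complex (a - s) (- b))"
    unfolding p_def h_orbit by (rule arg_cong[of _ _ csqrt]) (simp add: complex_eq_iff)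
  have eq_a: "p (orbit (a + 1)) = csqrt (Complex (- 1) (- b))"
    unfolding p_def h_orbit by (rule arg_cong[of _ _ csqrt]) (simp add: complex_eq_iff)
  have Re_a: "Re (p (orbit (a + 1))) \<le> b / 2"
  proof -
    have "1 + b\<^sup>2 \<le> (1 + b\<^sup>2 / 2)\<^sup>2"
      by (simp add: power2_sum power_divide)
    then have "sqrt (1 + b\<^sup>2) \<le> 1 + b\<^sup>2 / 2"
      by (intro real_le_lsqrt) (auto simp: add_nonneg_nonneg)
    then have "(sqrt (1 + b\<^sup>2) - 1) / 2 \<le> (b / 2)\<^sup>2"
      by (simp add: power_divide)
    then have "sqrt ((sqrt (1 + b\<^sup>2) - 1) / 2) \<le> b / 2"
      using b by (intro real_le_lsqrt) auto
    then show ?thesis by (simp add: eq_a cmod_def)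
  qed
  have Re_s: "c \<le> Re (p (orbit s))"
    using c(2) by (simp add: eq_s b_def)
  have pos: "0 < Re (p (orbit (a + 1)))" by (rule p_Re[OF orbit_in])
  have "2 * c / b \<le> Re (p (orbit s)) / Re (p (orbit (a + 1)))"
  proof -
    have "c / (b / 2) \<le> Re (p (orbit s)) / Re (p (orbit (a + 1)))"
      using Re_s Re_a pos c(1) by (intro frac_le) auto
    then show ?thesis by (simp add: mult.commute)
  qed
  then have "ln (2 * c / b) \<le> ln (Re (p (orbit s)) / Re (p (orbit (a + 1))))"
    using b c(1) by (intro ln_mono) (auto intro: less_le_trans)
  moreover have "ln (Re (p (orbit s)) / Re (p (orbit (a + 1)))) / 2
      \<le> hyp_dist (orbit s) (orbit (a + 1))"
    using Re_a Re_s c(3) p_Re p_hol orbit_in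
    by (intro hyp_dist_ge_ln_ratio_Re) (auto simp: b_def)
  ultimately show ?thesis by (simp add: b_def)
qed

text \<open>With \<open>s = a = t\<close> the first point lies directly below the tip of the slit, where the square
  root has real part \<open>sqrt (f (-t) / 2)\<close>; compared with \<open>f (-t) / 2\<close> one step later, the ratio tends
  to infinity.\<close>

lemma non_regular_orbit:
  assumes lim: "(f \<longlongrightarrow> 0) at_bot"
  shows "non_regular orbit"
proof -
  have f_lim: "((\<lambda>t. f (- t)) \<longlongrightarrow> 0) at_top"
    using lim by (simp add: filterlim_at_bot_mirror)
  then have f_right: "filterlim (\<lambda>t. f (- t)) (at_right 0) at_top"
    using f_pos by (auto simp: filterlim_at less_imp_neq[symmetric] intro!: always_eventually)
  have *: "ln (2 * sqrt (f (- t) / 2) / f (- t)) / 2 \<le> hyp_dist (orbit t) (orbit (t + 1))"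
    if t: "f (- t) < 2" for t
  proof (rule hyp_dist_orbit_ge)
    have "f (- t) / 2 * (f (- t) / 2) \<le> f (- t) / 2 * 1"
      using t f_pos[of "- t"] by (intro mult_left_mono) auto
    then have "f (- t) / 2 \<le> sqrt (f (- t) / 2)"
      using f_pos[of "- t"] by (intro real_le_rsqrt) (simp add: power2_eq_square)
    then show "f (- t) \<le> 2 * sqrt (f (- t) / 2)" by simp
    show "sqrt (f (- t) / 2) \<le> Re (csqrt (Complex (t - t) (- f (- t))))"
      using f_pos[of "- t"] by (simp add: cmod_def)
  qed (use f_pos in auto)
  have "filterlim (\<lambda>x::real. ln (2 * sqrt (x / 2) / x) / 2) at_top (at_right 0)"
    by real_asymp
  from filterlim_compose[OF this f_right]
  have "filterlim (\<lambda>t. ln (2 * sqrt (f (- t) / 2) / f (- t)) / 2) at_top at_top" .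
  moreover have "\<forall>\<^sub>F t in at_top. f (- t) < 2"
    using order_tendstoD(2)[OF f_lim, of 2] by simp
  ultimately have "filterlim (\<lambda>t. hyp_dist (orbit t) (orbit (t + 1))) at_top at_top"
    by (elim filterlim_at_top_mono eventually_mono) (rule *)
  then have "((\<lambda>t. ereal (hyp_dist (orbit t) (orbit (t + 1)))) \<longlongrightarrow> \<infinity>) at_top"
    by (simp add: tendsto_PInfty_eq_at_top)
  then show ?thesis
    unfolding non_regular_def by (intro lim_imp_Limsup) auto
qed

text \<open>The slit ends above \<open>1 - t\<close>, at least one unit behind \<open>0\<close>, so the image of \<open>orbit 0\<close> under
  the square root has real part at least \<open>1\<close>.\<close>

lemma hyp_dist_orbit_0_ge:
  assumes t: "2 \<le> t" and le: "f (1 - t) \<le> 2"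
  shows "ln (2 / f (1 - t)) / 2 \<le> hyp_dist (orbit 0) (orbit t)"
proof -
  have "1 \<le> Re (csqrt (Complex (t - 1) (- f (1 - t))))"
  proof -
    have "t - 1 \<le> cmod (Complex (t - 1) (- f (1 - t)))"
      using complex_Re_le_cmod[of "Complex (t - 1) (- f (1 - t))"] by simp
    then show ?thesis using t by simp
  qed
  then show ?thesis
    using hyp_dist_orbit_ge[of 0 "t - 1" 1] t le by simp
qed

text \<open>A line \<open>y = m (x + c)\<close> below the graph bounds a half-plane inside the domain, which contains
  the real segment from \<open>0\<close> to \<open>-t\<close> when \<open>t < c\<close>. Passing from this half-plane to the whole domain
  can only shrink distances, and in the half-plane they are explicit.\<close>

lemma Moebius_orbit_le_of_line_below:
  assumes m: "0 < m" and line: "\<And>x. m * (x + c) \<le> f x" and t: "0 \<le> t" "t < c"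
  shows "cmod (Moebius_function 0 (orbit 0) (orbit t))
    \<le> cmod (Complex (m * t) t / Complex (m * (2 * c - t)) t)"
proof -
  \<comment> \<open>The affine map \<open>j\<close> takes the right half-plane onto the half-plane below the line.\<close>
  define j where "j u = (u - of_real (m * c)) / Complex m 1" for u
  have m1: "Complex m 1 \<noteq> 0" by (simp add: complex_eq_iff)
  have j_in: "j u \<in> subgraph f" if "Re u > 0" for u
  proof -
    have "u = j u * Complex m 1 + of_real (m * c)"
      using m1 by (simp add: j_def)
    then have "Re u = Re (j u * Complex m 1 + of_real (m * c))" by (rule arg_cong)
    also have "\<dots> = m * (Re (j u) + c) - Im (j u)" by (simp add: algebra_simps)
    finally show ?thesis
      using that line[of "Re (j u)"] by (simp add: subgraph_def)
  qed
  have j_hol: "j holomorphic_on {u. Re u > 0}"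
    unfolding j_def using m1 by (intro holomorphic_intros) auto
  have kj_hol: "(\<lambda>u. k (j u)) holomorphic_on {u. Re u > 0}"
    using holomorphic_on_compose_gen[OF j_hol k_hol] j_in by (auto simp: o_def)
  let ?u = "Complex (m * (c - t)) (- t)" and ?v = "of_real (m * c) :: complex"
  have jv: "j ?v = 0" by (simp add: j_def)
  have ju: "j ?u = - of_real t"
  proof -
    have "?u - of_real (m * c) = - of_real t * Complex m 1"
      by (simp add: complex_eq_iff algebra_simps)
    then show ?thesis using m1 by (simp add: j_def)
  qed
  have "cmod (Moebius_function 0 (k (j ?v)) (k (j ?u))) \<le> cmod ((?u - ?v) / (?u + cnj ?v))"
    using m t by (intro Schwarz_Pick_halfplane_to_disk kj_hol k_in j_in) auto
  also have "?u - ?v = - Complex (m * t) t"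
    by (simp add: complex_eq_iff algebra_simps)
  also have "?u + cnj ?v = cnj (Complex (m * (2 * c - t)) t)"
    by (simp add: complex_eq_iff algebra_simps)
  finally show ?thesis
    unfolding jv ju by (simp add: orbit_def norm_divide)
qed

end

text \<open>Shearing the lower half-plane vertically by \<open>f\<close> shows that the domain is simply connected,
  so that the Riemann mapping theorem applies.\<close>

lemma koenigs_model_exists:
  assumes "strict_mono f" and pos: "\<And>x. 0 < f x" and cont: "continuous_on UNIV f"
  shows "\<exists>h k. koenigs_model f h k"
proof -
  let ?L = "{w. Im w < 0}"
  have fRe: "continuous_on S (\<lambda>w. f (Re w))" for S
    by (rule continuous_on_compose2[OF cont]) (auto intro!: continuous_intros)
  let ?u = "\<lambda>w. Complex (Re w) (Im w + f (Re w))" and ?d = "\<lambda>w. Complex (Re w) (Im w - f (Re w))"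
  have "?L homeomorphic subgraph f"
  proof (rule homeomorphicI[of ?u _ _ ?d])
    show "continuous_on ?L ?u" "continuous_on (subgraph f) ?d"
      unfolding Complex_eq by (intro continuous_intros fRe)+
    have 1: "?u ` ?L \<subseteq> subgraph f" and 2: "?d ` subgraph f \<subseteq> ?L"
      by (auto simp: subgraph_def)
    show "?u ` ?L = subgraph f"
      using 1 image_mono[OF 2, of ?u] by (simp add: image_image)
    show "?d ` subgraph f = ?L"
      using 2 image_mono[OF 1, of ?d] by (simp add: image_image)
  qed (simp_all add: complex_eq_iff)
  moreover have "simply_connected ?L"
    by (intro convex_imp_simply_connected convex_halfspace_Im_lt)
  ultimately have "simply_connected (subgraph f)"
    using homeomorphic_simply_connected by blast
  moreover have "open (subgraph f)"
    unfolding subgraph_def by (intro open_Collect_less continuous_intros fRe)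
  moreover have "subgraph f \<noteq> {}" "subgraph f \<noteq> UNIV"
  proof -
    have "0 \<in> subgraph f" "Complex 0 (f 0) \<notin> subgraph f"
      using pos by (auto simp: subgraph_def)
    then show "subgraph f \<noteq> {}" "subgraph f \<noteq> UNIV" by auto
  qed
  ultimately obtain k h where
    "k holomorphic_on subgraph f" "h holomorphic_on unit_disk"
    "\<forall>z \<in> subgraph f. k z \<in> unit_disk \<and> h (k z) = z"
    "\<forall>z \<in> unit_disk. h z \<in> subgraph f \<and> k (h z) = z"
    using Riemann_mapping_theorem[of "subgraph f"] by blast
  then have "koenigs_model f h k"
    using assms(1) pos by unfold_locales auto
  then show ?thesis by blast
qed

section \<open>The two examples\<close>

text \<open>Under the exponential graph, the tangent at \<open>-t\<close> bounds a half-plane in which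
  \<open>orbit 0\<close> and \<open>orbit t\<close> are \<open>t + O(ln t)\<close> apart.\<close>

lemma hyp_dist_orbit_exp_le:
  assumes "koenigs_model exp h k" and t: "0 \<le> t"
  shows "hyp_dist (koenigs_model.orbit k 0) (koenigs_model.orbit k t) \<le> t + ln (4 * (1 + t)) / 2"
proof -
  interpret koenigs_model exp h k by fact
  define m where "m = exp (- t)"
  have m: "0 < m" "m \<le> 1" using t by (auto simp: m_def)
  have tangent: "m * (x + (1 + t)) \<le> exp x" for x
  proof -
    have "m * (1 + (x + t)) \<le> m * exp (x + t)"
      using m by (intro mult_left_mono exp_ge_add_one_self) auto
    also have "\<dots> = exp x" by (simp add: m_def flip: exp_add)
    finally show ?thesis by (simp add: algebra_simps)
  qed
  define r where "r = cmod (Complex (m * t) t / Complex (m * (2 * (1 + t) - t)) t)"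
  have le_r: "cmod (Moebius_function 0 (orbit 0) (orbit t)) \<le> r"
    unfolding r_def using m t tangent by (intro Moebius_orbit_le_of_line_below) auto
  \<comment> \<open>\<open>Q\<close> is the squared modulus of the denominator of \<open>r\<close>.\<close>
  define Q where "Q = m\<^sup>2 * (2 + t)\<^sup>2 + t\<^sup>2"
  have Q: "0 < Q" using m t by (auto simp: Q_def intro!: add_pos_nonneg)
  have r2: "1 - r\<^sup>2 = 4 * m\<^sup>2 * (1 + t) / Q"
  proof -
    have "r\<^sup>2 = (m\<^sup>2 * t\<^sup>2 + t\<^sup>2) / Q"
      by (simp add: r_def norm_divide power_divide cmod_power2 Q_def power_mult_distrib add.commute)
    then have "1 - r\<^sup>2 = (Q - (m\<^sup>2 * t\<^sup>2 + t\<^sup>2)) / Q"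
      using Q by (simp add: diff_divide_distrib)
    also have "Q - (m\<^sup>2 * t\<^sup>2 + t\<^sup>2) = 4 * m\<^sup>2 * (1 + t)"
      by (simp add: Q_def power2_eq_square algebra_simps)
    finally show ?thesis .
  qed
  have r0: "0 \<le> r" by (simp add: r_def)
  have "0 < 1 - r\<^sup>2" unfolding r2 using m t Q by simp
  then have r1: "r < 1" using r0 by (simp add: power_less_one_iff abs_square_less_1)
  have "Q \<le> (2 + t)\<^sup>2 + t\<^sup>2"
    using m t by (simp add: Q_def mult_left_le_one_le power_le_one)
  also have "\<dots> \<le> 4 * (1 + t) * (1 + t)"
    using t by (simp add: power2_eq_square algebra_simps)
  finally have Q_le: "Q \<le> 4 * (1 + t) * (1 + t)" .
  have "1 - r\<^sup>2 = (1 - r) * (1 + r)"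
    by (simp add: power2_eq_square algebra_simps)
  then have "(1 + r) / (1 - r) = (1 + r)\<^sup>2 / (1 - r\<^sup>2)"
    using r0 r1 by (simp add: power2_eq_square)
  also have "\<dots> \<le> 4 / (1 - r\<^sup>2)"
    using r0 r1 \<open>0 < 1 - r\<^sup>2\<close> power_mono[of "1 + r" 2 2] by (intro divide_right_mono) auto
  also have "\<dots> = Q / (m\<^sup>2 * (1 + t))"
    unfolding r2 by simp
  also have "\<dots> \<le> 4 * (1 + t) * (1 + t) / (m\<^sup>2 * (1 + t))"
    using Q_le m t by (intro divide_right_mono) auto
  also have "\<dots> = 4 * (1 + t) * exp (2 * t)"
    using m t by (simp add: m_def exp_minus field_simps flip: exp_double)
  finally have "ln ((1 + r) / (1 - r)) \<le> ln (4 * (1 + t) * exp (2 * t))"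
    using r0 r1 by (intro ln_mono) auto
  also have "\<dots> = ln (4 * (1 + t)) + 2 * t"
    using t by (simp add: ln_mult)
  finally have "artanh r \<le> t + ln (4 * (1 + t)) / 2"
    by (simp add: artanh_def)
  moreover have "hyp_dist (orbit 0) (orbit t) \<le> artanh r"
    unfolding hyp_dist_eq_artanh_Moebius using le_r r1 by (intro artanh_mono_real) auto
  ultimately show ?thesis by simp
qed

theorem proposition6p1:
  shows "(\<exists>(\<phi> :: real \<Rightarrow> complex \<Rightarrow> complex) (\<gamma> :: real \<Rightarrow> complex) (\<zeta> :: complex).
            semigroup_in_disk \<phi> \<and> \<not> group_in_disk \<phi> \<and>
            backward_orbit \<phi> \<gamma> \<and> non_regular \<gamma> \<and> \<zeta> \<in> \<gamma> ` {0..} \<and>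
            ((\<lambda>t. hyp_dist \<zeta> (semigroup_at \<phi> t \<zeta>) / t\<^sup>2) \<longlongrightarrow> 0) at_bot)
       \<and> (\<exists>(\<psi> :: real \<Rightarrow> complex \<Rightarrow> complex) (\<gamma>' :: real \<Rightarrow> complex) (\<zeta> :: complex).
            semigroup_in_disk \<psi> \<and> \<not> group_in_disk \<psi> \<and>
            backward_orbit \<psi> \<gamma>' \<and> non_regular \<gamma>' \<and> \<zeta> \<in> \<gamma>' ` {0..} \<and>
            Liminf at_bot (\<lambda>t. ereal (hyp_dist \<zeta> (semigroup_at \<psi> t \<zeta>) / t\<^sup>2)) \<ge> ereal (1 / 4))"
proof (intro conjI)
  have "strict_mono (exp :: real \<Rightarrow> real)" by (simp add: strict_mono_def)
  then obtain h k where "koenigs_model exp h k"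
    using koenigs_model_exists[of exp] continuous_on_exp[OF continuous_on_id] by auto
  then interpret koenigs_model exp h k .
  have lim: "((\<lambda>t. hyp_dist (orbit 0) (semigroup_at flow t (orbit 0)) / t\<^sup>2) \<longlongrightarrow> 0) at_bot"
    unfolding filterlim_at_bot_mirror
  proof (rule tendsto_sandwich)
    show "((\<lambda>t::real. 0 :: real) \<longlongrightarrow> 0) at_top" by simp
    show "((\<lambda>t::real. (t + ln (4 * (1 + t)) / 2) / t\<^sup>2) \<longlongrightarrow> 0) at_top" by real_asymp
    show "\<forall>\<^sub>F t in at_top. 0 \<le> hyp_dist (orbit 0) (semigroup_at flow (- t) (orbit 0)) / (- t)\<^sup>2"
      using eventually_ge_at_top[of 0]
      by eventually_elim
        (use hyp_dist_nonneg[OF orbit_in orbit_in] in \<open>simp add: semigroup_at_orbit\<close>)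
    show "\<forall>\<^sub>F t in at_top. hyp_dist (orbit 0) (semigroup_at flow (- t) (orbit 0)) / (- t)\<^sup>2
        \<le> (t + ln (4 * (1 + t)) / 2) / t\<^sup>2"
      using eventually_ge_at_top[of 0]
    proof eventually_elim
      case (elim t)
      show ?case
        using hyp_dist_orbit_exp_le[OF \<open>koenigs_model exp h k\<close> elim]
        by (simp add: semigroup_at_orbit[OF elim] divide_right_mono)
    qed
  qed
  show "\<exists>\<phi> \<gamma> \<zeta>. semigroup_in_disk \<phi> \<and> \<not> group_in_disk \<phi> \<and> backward_orbit \<phi> \<gamma> \<and>
      non_regular \<gamma> \<and> \<zeta> \<in> \<gamma> ` {0..} \<and>
      ((\<lambda>t. hyp_dist \<zeta> (semigroup_at \<phi> t \<zeta>) / t\<^sup>2) \<longlongrightarrow> 0) at_bot"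
    using semigroup_flow not_group_flow backward_orbit_orbit non_regular_orbit[OF exp_at_bot] lim
    by (intro exI[of _ flow] exI[of _ orbit] exI[of _ "orbit 0"]) auto
next
  define f :: "real \<Rightarrow> real" where "f x = exp (- exp (- x))" for x
  have "strict_mono f" by (simp add: f_def strict_mono_def)
  moreover have "continuous_on UNIV f" unfolding f_def by (intro continuous_intros)
  ultimately obtain h k where "koenigs_model f h k"
    using koenigs_model_exists[of f] by (auto simp: f_def)
  then interpret koenigs_model f h k .
  have f_lim: "(f \<longlongrightarrow> 0) at_bot" unfolding f_def by real_asymp
  have "\<forall>\<^sub>F t::real in at_top. 1 / 4 * t\<^sup>2 \<le> exp (t - 1) / 2" by real_asymp
  then have "\<forall>\<^sub>F t in at_top. 1 / 4 \<le> hyp_dist (orbit 0) (semigroup_at flow (- t) (orbit 0)) / (- t)\<^sup>2"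
    using eventually_ge_at_top[of 2]
  proof eventually_elim
    case (elim t)
    have "f (1 - t) \<le> 1" by (simp add: f_def)
    then have "ln (2 / f (1 - t)) / 2 \<le> hyp_dist (orbit 0) (orbit t)"
      using elim by (intro hyp_dist_orbit_0_ge) auto
    moreover have "ln (2 / f (1 - t)) = ln 2 + exp (t - 1)"
      by (simp add: f_def ln_div)
    moreover have "0 \<le> ln (2::real)" by simp
    ultimately have "1 / 4 * t\<^sup>2 \<le> hyp_dist (orbit 0) (orbit t)"
      using elim by linarith
    then show ?case
      using elim by (simp add: semigroup_at_orbit le_divide_eq)
  qed
  then have "\<forall>\<^sub>F t in at_bot. 1 / 4 \<le> hyp_dist (orbit 0) (semigroup_at flow t (orbit 0)) / t\<^sup>2"
    by (simp add: at_bot_mirror eventually_filtermap)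
  then have "ereal (1 / 4) \<le> Liminf at_bot
      (\<lambda>t. ereal (hyp_dist (orbit 0) (semigroup_at flow t (orbit 0)) / t\<^sup>2))"
    by (intro Liminf_bounded) (auto elim!: eventually_mono)
  then show "\<exists>\<psi> \<gamma>' \<zeta>. semigroup_in_disk \<psi> \<and> \<not> group_in_disk \<psi> \<and> backward_orbit \<psi> \<gamma>' \<and>
      non_regular \<gamma>' \<and> \<zeta> \<in> \<gamma>' ` {0..} \<and>
      Liminf at_bot (\<lambda>t. ereal (hyp_dist \<zeta> (semigroup_at \<psi> t \<zeta>) / t\<^sup>2)) \<ge> ereal (1 / 4)"
    using semigroup_flow not_group_flow backward_orbit_orbit non_regular_orbit[OF f_lim]
    by (intro exI[of _ flow] exI[of _ orbit] exI[of _ "orbit 0"]) auto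
qed

end
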